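(* Let $X$ be a nonempty set and let $i,j\in\{1,2,3,4\}$ with $j<i$. An operation $F\colon X^2\to X$ is $(i,j)$-selective if and only if $F$ is constant.
   Context: For $i,j\in\{1,2,3,4\}$, an operation $F\colon X^2\to X$ is $(i,j)$-selective if $F(F(x_1,x_2),F(x_3,x_4))=F(x_i,x_j)$ for all $x_1,x_2,x_3,x_4\in X$. *)

theory Defs
  imports "HOL-Library.FuncSet" "HOL-Analysis.Abstract_Topology_2"
begin

(* The quadruple (x_1, x_2, x_3, x_4) of elements of X is a function x mapping {1..4} into X,
   so that x_i is x i; its values outside {1..4} are irrelevant when i and j lie in {1..4}. *)
definition selective :: "nat \<Rightarrow> nat \<Rightarrow> 'a set \<Rightarrow> ('a \<times> 'a \<Rightarrow> 'a) \<Rightarrow> bool" where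
  "selective i j X F \<longleftrightarrow>
     (\<forall>x \<in> {1..4} \<rightarrow> X. F (F (x 1, x 2), F (x 3, x 4)) = F (x i, x j))"

end

(* Evaluating ((a1 b1)(a2 b2))((a3 b3)(a4 b4)) once from the outside and once from the inside
   equates two products; for j < i their factors are four distinct variables, so F is constant. *)
theory Submission
  imports Defs
begin

text \<open>Write xy for \<open>F (x, y)\<close> and evaluate an eightfold product with blocks xk =
  ak bk. The law applied to the four blocks leaves xi xj, which it reduces again to a product of two
  variables; applied to each half first and then to the result, it gives another such product.
  Whenever j < i the two products share no variable, so all values of \<open>F\<close> agree. For
  constant \<open>F\<close> both sides of the law are that constant.\<close>

text \<open>The shift \<open>k - 1\<close> matches quadruples indexed from 1 with lists indexed from
  0.\<close>

lemma selectiveD: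
  assumes "selective i j X F" and "a \<in> X" "b \<in> X" "c \<in> X" "d \<in> X"
  shows "F (F (a, b), F (c, d)) =
    F ((\<lambda>k. [a, b, c, d] ! (k - 1)) i, (\<lambda>k. [a, b, c, d] ! (k - 1)) j)"
proof -
  have "(\<lambda>k. [a, b, c, d] ! (k - 1)) \<in> {1..4} \<rightarrow> X"
    using assms(2-5) by (auto simp: nth_Cons split: nat.split)
  from bspec [OF assms(1)[unfolded selective_def] this] show ?thesis
    by (simp add: numeral_eq_Suc)
qed

theorem proposition2p4:
  fixes X :: "'a set" and F :: "'a \<times> 'a \<Rightarrow> 'a" and i j :: nat
  assumes "X \<noteq> {}"
    and "i \<in> {1, 2, 3, 4}" and "j \<in> {1, 2, 3, 4}" and "j < i"
    and "F \<in> X \<times> X \<rightarrow> X"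
  shows "selective i j X F \<longleftrightarrow> F constant_on (X \<times> X)"
proof
  assume sel: "selective i j X F"
  have closed: "F (a, b) \<in> X" if "a \<in> X" "b \<in> X" for a b
    using assms(5) that by auto
  have "F (p, q) = F (r, s)" if "p \<in> X" "q \<in> X" "r \<in> X" "s \<in> X" for p q r s
  proof -
    consider "i = 2" "j = 1" | "i = 3" "j = 1" | "i = 4" "j = 1"
      | "i = 3" "j = 2" | "i = 4" "j = 2" | "i = 4" "j = 3"
      using assms(2-4) by auto
    then show ?thesis
    proof cases
      case 1
      have "F (F (a, b), F (c, d)) = F (b, a)" if "a \<in> X" "b \<in> X" "c \<in> X" "d \<in> X" for a b c d
        using selectiveD [OF sel that] 1 by (simp add: numeral_eq_Suc)
      \<comment> \<open>The two evaluations give b2 a2 = a1 b1; \<open>closed\<close> lets products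
        serve as arguments of the law.\<close>
      then show ?thesis using that closed by metis
    next
      case 2
      have "F (F (a, b), F (c, d)) = F (c, a)" if "a \<in> X" "b \<in> X" "c \<in> X" "d \<in> X" for a b c d
        using selectiveD [OF sel that] 2 by (simp add: numeral_eq_Suc)
      \<comment> \<open>Here a1 a3 = a4 a2.\<close>
      then show ?thesis using that closed by metis
    next
      case 3
      have "F (F (a, b), F (c, d)) = F (d, a)" if "a \<in> X" "b \<in> X" "c \<in> X" "d \<in> X" for a b c d
        using selectiveD [OF sel that] 3 by (simp add: numeral_eq_Suc)
      \<comment> \<open>Here b1 a4 = a3 b2.\<close>
      then show ?thesis using that closed by metis
    next
      case 4
      have "F (F (a, b), F (c, d)) = F (c, b)" if "a \<in> X" "b \<in> X" "c \<in> X" "d \<in> X" for a b c d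
        using selectiveD [OF sel that] 4 by (simp add: numeral_eq_Suc)
      \<comment> \<open>Here a2 b3 = a4 b1.\<close>
      then show ?thesis using that closed by metis
    next
      case 5
      have "F (F (a, b), F (c, d)) = F (d, b)" if "a \<in> X" "b \<in> X" "c \<in> X" "d \<in> X" for a b c d
        using selectiveD [OF sel that] 5 by (simp add: numeral_eq_Suc)
      \<comment> \<open>Here b2 b4 = b3 b1.\<close>
      then show ?thesis using that closed by metis
    next
      case 6
      have "F (F (a, b), F (c, d)) = F (d, c)" if "a \<in> X" "b \<in> X" "c \<in> X" "d \<in> X" for a b c d
        using selectiveD [OF sel that] 6 by (simp add: numeral_eq_Suc)
      \<comment> \<open>Here b3 a3 = a4 b4.\<close>
      then show ?thesis using that closed by metis
    qed
  qed
  with assms(1) show "F constant_on (X \<times> X)"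
    unfolding constant_on_def by fast
next
  assume "F constant_on (X \<times> X)"
  then obtain c where c: "F (a, b) = c" if "a \<in> X" "b \<in> X" for a b
    unfolding constant_on_def by auto
  show "selective i j X F"
    unfolding selective_def
  proof
    fix x :: "nat \<Rightarrow> 'a" assume "x \<in> {1..4} \<rightarrow> X"
    then have x: "x k \<in> X" if "k \<in> {1, 2, 3, 4}" for k
      using that by auto
    \<comment> \<open>Constancy is known only on pairs from \<open>X\<close>, so the arguments of
      the outer \<open>F\<close> must be seen to lie there.\<close>
    have "F (x 1, x 2) \<in> X" "F (x 3, x 4) \<in> X"
      using assms(5) x by auto
    then show "F (F (x 1, x 2), F (x 3, x 4)) = F (x i, x j)"
      using c x assms(2,3) by metis
  qed
qed

end
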